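(* Assume that the $\mathscr{B}$-free subshift $(X_\eta,S)$ satisfies $X_\eta=X_{\mathscr{B}}$, where $X_{\mathscr{B}}$ is the $\mathscr{B}$-admissible subshift. Then: (1) $(X_\eta,S)$ satisfies the Garden of Eden theorem, i.e., a cellular automaton $\tau:X_\eta\to X_\eta$ is surjective if and only if it is pre-injective. (2) Every cellular automaton is given by a monotone code modulo a power of the shift: for every cellular automaton $\tau:X_\eta\to X_\eta$ there is $t\in\mathbb{Z}$ such that $\tau\circ S^t$ is given by a monotone code. (3) If a cellular automaton $\tau:X_\eta\to X_\eta$ is surjective, then $\tau=S^t$ for some $t\in\mathbb{Z}$.
   Context: $\mathscr{B}\subset\mathbb{N}=\{1,2,\dots\}$ is assumed primitive (no element of $\mathscr{B}$ divides another element of $\mathscr{B}$) and $\mathscr{B}\neq\{1\}$. Put $\mathcal{F}_{\mathscr{B}}=\mathbb{Z}\setminus\bigcup_{b\in\mathscr{B}}b\mathbb{Z}$ and let $\eta\in\{0,1\}^{\mathbb{Z}}$ be its characteristic function. Let $S$ be the left shift on $\{0,1\}^{\mathbb{Z}}$ (product topology), $(Sx)(j)=x(j+1)$. The $\mathscr{B}$-free subshift is $(X_\eta,S)$ with $X_\eta=\overline{\{S^r\eta: r\in\mathbb{Z}\}}$. A set $A\subset\mathbb{Z}$ is $\mathscr{B}$-admissible if for every $b\in\mathscr{B}$ the set $\{a \bmod b: a\in A\}$ has fewer than $b$ elements. With $\mathrm{supp}(x)=\{j: x(j)\neq 0\}$, put $X_{\mathscr{B}}=\{x\in\{0,1\}^{\mathbb{Z}}: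 \mathrm{supp}(x)\text{ is }\mathscr{B}\text{-admissible}\}$. A cellular automaton (CA) on a subshift $(X,S)$ is a continuous map $\tau:X\to X$ commuting with $S$. It is given by a code $\phi:\{0,1\}^{\{-\ell,\dots,\ell\}}\to\{0,1\}$ ($\ell\ge 0$) if $\tau(x)(n)=\phi(x(n-\ell,n+\ell))$ for all $x\in X$, $n\in\mathbb{Z}$, where $x(n-\ell,n+\ell)$ is the block of $x$ on positions $n-\ell,\dots,n+\ell$, re-indexed by $\{-\ell,\dots,\ell\}$; only blocks that appear in some $x\in X$ are considered. A code $\phi$ is monotone if $\phi(B)\le B(0)$ for each block $B$ considered. A CA $\tau$ on $X$ is pre-injective if for any $x,y\in X$, $\tau(x)=\tau(y)$ implies that either $x=y$ or $x$ and $y$ differ at infinitely many coordinates. *)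

theory Defs
  imports "HOL-Analysis.Analysis"
begin

text \<open>
  A configuration in \<open>{0,1}\<^sup>\<int>\<close> is a function of type \<^typ>\<open>int \<Rightarrow> bool\<close>, with \<^term>\<open>True\<close> in the
  role of 1 and \<^term>\<open>False\<close> in the role of 0, so that the order of \<^typ>\<open>bool\<close> is the order
  \<open>0 < 1\<close>.  The topology on configurations is the library's product topology on functions, over
  the library's (discrete) topology on \<^typ>\<open>bool\<close>.
\<close>

type_synonym config = "int \<Rightarrow> bool"

definition shift :: "config \<Rightarrow> config" where
  "shift x = (\<lambda>j. x (j + 1))"

definition shift_power :: "int \<Rightarrow> config \<Rightarrow> config" where
  "shift_power t = (if 0 \<le> t then shift ^^ nat t else inv shift ^^ nat (- t))"

definition free_integers :: "nat set \<Rightarrow> int set" where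
  "free_integers B = UNIV - (\<Union>b\<in>B. range (\<lambda>k. int b * k))"

definition eta :: "nat set \<Rightarrow> config" where
  "eta B = (\<lambda>j. j \<in> free_integers B)"

definition free_subshift :: "nat set \<Rightarrow> config set" where
  "free_subshift B = closure (range (\<lambda>r. shift_power r (eta B)))"

definition support :: "config \<Rightarrow> int set" where
  "support x = {j. x j}"

definition admissible :: "nat set \<Rightarrow> int set \<Rightarrow> bool" where
  "admissible B A \<longleftrightarrow> (\<forall>b\<in>B. card ((\<lambda>a. a mod int b) ` A) < b)"

definition admissible_subshift :: "nat set \<Rightarrow> config set" where
  "admissible_subshift B = {x. admissible B (support x)}"

definition primitive :: "nat set \<Rightarrow> bool" where
  "primitive B \<longleftrightarrow> (\<forall>a\<in>B. \<forall>b\<in>B. a dvd b \<longrightarrow> a = b)"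

text \<open>
  Maps of \<open>X\<close> are represented by total functions on configurations; their values outside \<open>X\<close> are
  irrelevant, and equality of maps of \<open>X\<close> has to be read as equality on \<open>X\<close>.
\<close>

definition cellular_automaton :: "config set \<Rightarrow> (config \<Rightarrow> config) \<Rightarrow> bool" where
  "cellular_automaton X \<tau> \<longleftrightarrow>
     \<tau> ` X \<subseteq> X \<and> continuous_on X \<tau> \<and> (\<forall>x\<in>X. \<tau> (shift x) = shift (\<tau> x))"

text \<open>
  The block of \<open>x\<close> on the positions \<open>n - l, \<dots>, n + l\<close>, re-indexed by \<open>{-l..l}\<close>; it is an
  extensional function, i.e. it has a fixed value outside \<open>{-l..l}\<close>, so that the blocks correspond
  exactly to the functions on \<open>{-l..l}\<close>.
\<close>

definition block :: "config \<Rightarrow> int \<Rightarrow> nat \<Rightarrow> config" where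
  "block x n l = restrict (\<lambda>i. x (n + i)) {- int l..int l}"

definition blocks :: "config set \<Rightarrow> nat \<Rightarrow> config set" where
  "blocks X l = {block x n l | x n. x \<in> X}"

definition given_by_code ::
    "config set \<Rightarrow> nat \<Rightarrow> (config \<Rightarrow> bool) \<Rightarrow> (config \<Rightarrow> config) \<Rightarrow> bool" where
  "given_by_code X l \<phi> \<tau> \<longleftrightarrow> (\<forall>x\<in>X. \<forall>n. \<tau> x n = \<phi> (block x n l))"

definition monotone_code :: "config set \<Rightarrow> nat \<Rightarrow> (config \<Rightarrow> bool) \<Rightarrow> bool" where
  "monotone_code X l \<phi> \<longleftrightarrow> (\<forall>C\<in>blocks X l. \<phi> C \<le> C 0)"

definition pre_injective_on :: "config set \<Rightarrow> (config \<Rightarrow> config) \<Rightarrow> bool" where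
  "pre_injective_on X \<tau> \<longleftrightarrow>
     (\<forall>x\<in>X. \<forall>y\<in>X. \<tau> x = \<tau> y \<longrightarrow> x = y \<or> infinite {j. x j \<noteq> y j})"

lemma inv_shift: "inv shift x = (\<lambda>j. x (j - 1))"
proof (rule inv_f_eq)
  show "inj shift"
  proof (rule injI)
    fix x y :: config
    assume "shift x = shift y"
    then have "x (j - 1 + 1) = y (j - 1 + 1)" for j
      unfolding shift_def by meson
    then show "x = y" by auto
  qed
qed (simp add: shift_def)

lemma shift_power_apply: "shift_power t x j = x (j + t)"
proof -
  have "(shift ^^ n) x j = x (j + int n)" for n
    by (induction n arbitrary: j) (auto simp: shift_def algebra_simps)
  moreover have "(inv shift ^^ n) x j = x (j - int n)" for n
    by (induction n arbitrary: j) (auto simp: inv_shift algebra_simps)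
  ultimately show ?thesis by (simp add: shift_power_def)
qed

end

theory Submission
  imports Defs "HOL-Number_Theory.Cong"
begin

text \<open>
  Since every admissible finite pattern occurs in \<open>\<eta>\<close>, the elements of \<open>B\<close> are pairwise coprime:
  for a non-coprime pair one finds a finite admissible set whose missed classes modulo the pair
  cannot be realised by one translation. By the zero pattern, \<open>B\<close> is infinite. Hence, by the
  Chinese remainder theorem, finite admissible patterns can be placed at far apart positions in
  prescribed classes modulo one large \<open>b\<close> while staying admissible. This forces a coordinate \<open>t\<close>
  with \<open>\<tau> x 0 \<longrightarrow> x t\<close>, so that up to a shift \<open>\<tau> x \<le> x\<close>. A map of this kind is the identity both
  if it is onto (test it on configurations that are maximal around the origin) and if it is
  injective on finite configurations (induction on the support).
\<close>

section \<open>Admissible sets and congruences\<close>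

text \<open>There are \<open>b\<close> residues modulo \<open>b\<close>, so meeting fewer than
  \<open>b\<close> of them means missing one. A missed class given by an unreduced integer
  \<open>c\<close> is easy to translate and to combine with others.\<close>

lemma admissible_iff_missed_class:
  assumes "0 \<notin> B"
  shows "admissible B A \<longleftrightarrow> (\<forall>b\<in>B. \<exists>c. \<forall>a\<in>A. \<not> [a = c] (mod int b))"
proof -
  have "card ((\<lambda>a. a mod int b) ` A) < b \<longleftrightarrow> (\<exists>c. \<forall>a\<in>A. \<not> [a = c] (mod int b))" if "b \<in> B" for b
  proof -
    have b: "b > 0" using that assms by (metis gr0I)
    let ?R = "(\<lambda>a. a mod int b) ` A"
    have sub: "?R \<subseteq> {0..<int b}" using b by auto
    show ?thesis
    proof
      assume "card ?R < b"
      then obtain c where "c \<in> {0..<int b}" "c \<notin> ?R"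
        using sub by (metis card_atLeastLessThan_int diff_zero nat_int nat_neq_iff subsetI subset_antisym)
      then show "\<exists>c. \<forall>a\<in>A. \<not> [a = c] (mod int b)"
        by (intro exI[of _ c]) (auto simp: cong_def)
    next
      assume "\<exists>c. \<forall>a\<in>A. \<not> [a = c] (mod int b)"
      then obtain c where "\<forall>a\<in>A. \<not> [a = c] (mod int b)" by blast
      then have "c mod int b \<notin> ?R" by (auto simp: cong_def)
      moreover have "c mod int b \<in> {0..<int b}" using b by simp
      ultimately have "?R \<subset> {0..<int b}" using sub by blast
      then have "card ?R < card {0..<int b}" by (intro psubset_card_mono) auto
      then show "card ?R < b" by simp
    qed
  qed
  then show ?thesis by (simp add: admissible_def)
qed

text \<open>This reduces admissibility of a finite set to finitely many moduli.\<close>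

lemma small_set_misses_class:
  assumes "finite A" "card A < b"
  shows "\<exists>c. \<forall>a\<in>A. \<not> [a = c] (mod int b)"
proof -
  have "card ((\<lambda>a. a mod int b) ` A) < b"
    using card_image_le[OF assms(1)] assms(2) by (rule le_less_trans)
  then have "admissible {b} A" by (simp add: admissible_def)
  then show ?thesis using assms(2) by (subst (asm) admissible_iff_missed_class) auto
qed

lemma admissible_mono: "0 \<notin> B \<Longrightarrow> admissible B A \<Longrightarrow> A' \<subseteq> A \<Longrightarrow> admissible B A'"
  by (simp add: admissible_iff_missed_class) (meson subsetD)

text \<open>Take \<open>q = u + w * k\<close>, where \<open>k\<close> is the product of the primes
  dividing \<open>L\<close> but not \<open>u\<close>. A prime factor of \<open>L\<close> that
  divides \<open>u\<close> divides neither \<open>w\<close> nor \<open>k\<close>; one that does not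
  divide \<open>u\<close> divides \<open>k\<close>. Neither kind divides \<open>q\<close>.\<close>

lemma ex_coprime_cong:
  fixes u w L :: int
  assumes "coprime u w" "L \<noteq> 0"
  shows "\<exists>q. coprime q L \<and> [q = u] (mod w)"
proof -
  let ?k = "\<Prod>{p. prime p \<and> p dvd L \<and> \<not> p dvd u}"
  have fin: "finite {p. prime p \<and> p dvd L \<and> \<not> p dvd u}"
    by (rule finite_subset[OF _ finite_prime_divisors[OF assms(2)]]) auto
  have "coprime (u + w * ?k) L"
  proof (rule ccontr)
    assume "\<not> coprime (u + w * ?k) L"
    then obtain c where c: "c dvd u + w * ?k" "c dvd L" "\<not> is_unit c"
      by (rule not_coprimeE)
    obtain p where p: "prime p" "p dvd u + w * ?k" "p dvd L"
    proof -
      have "c \<noteq> 0" using c(2) assms(2) by auto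
      then obtain p where "prime p" "p dvd c" using c(3) by (metis prime_divisorE)
      then show thesis using c that by (meson dvd_trans)
    qed
    show False
    proof (cases "p dvd u")
      case True
      then have "p dvd w * ?k" using p(2) by (simp add: dvd_add_right_iff)
      then consider "p dvd w" | "p dvd ?k" using p(1) prime_dvd_mult_iff by blast
      then show False
      proof cases
        case 1
        then show ?thesis using True assms(1) p(1) by (meson coprime_common_divisor not_prime_unit)
      next
        case 2
        then obtain q where "prime q" "\<not> q dvd u" "p dvd q"
          using prime_dvd_prod_iff[OF fin p(1), of "\<lambda>x. x"] by auto
        then show ?thesis using True p(1) primes_dvd_imp_eq by blast
      qed
    next
      case False
      then have "p dvd ?k" using p fin by (intro dvd_prodI) auto
      then show ?thesis using False p(2) by (simp add: dvd_add_left_iff)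
    qed
  qed
  then show ?thesis by (intro exI[of _ "u + w * ?k"]) (auto simp: cong_def)
qed

text \<open>The residue \<open>i\<close> is represented by \<open>gcd(i, m) \<cdot> q\<close> with \<open>q\<close> coprime to all of \<open>D\<close>; an element
  of \<open>D\<close> dividing it would divide \<open>m\<close>.\<close>

lemma ex_cong_not_multiple:
  fixes m :: nat and i :: int
  assumes D: "finite D" "0 \<notin> D" and m: "m > 0" "\<not> int m dvd i" and prim: "\<And>d. d \<in> D \<Longrightarrow> d dvd m \<Longrightarrow> d = m"
  shows "\<exists>n. [n = i] (mod int m) \<and> (\<forall>d\<in>D. \<not> int d dvd n \<and> gcd n (int d) dvd int m)"
proof -
  define g where "g = gcd i (int m)"
  have g: "g dvd i" "g dvd int m" "g > 0" using m(1) by (auto simp: g_def)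
  have "coprime (i div g) (int m div g)"
    using m(1) unfolding g_def by (intro div_gcd_coprime) auto
  moreover have "int (\<Prod>D) \<noteq> 0" using D by auto
  ultimately obtain q where q: "coprime q (int (\<Prod>D))" "[q = i div g] (mod (int m div g))"
    using ex_coprime_cong by blast
  have "[g * q = g * (i div g)] (mod g * (int m div g))"
    using q(2) g(3) by (simp add: cong_cmult_leftI)
  then have 1: "[g * q = i] (mod int m)" using g by simp
  have 2: "gcd (g * q) (int d) dvd g" if "d \<in> D" for d
  proof -
    have "int d dvd int (\<Prod>D)" using that D by (simp add: dvd_prodI)
    then have "coprime q (int d)" using q(1) by (meson coprime_divisors dvd_refl)
    then show ?thesis by (simp add: gcd_mult_right_right_cancel gcd_mult_left_right_cancel coprime_commute)
  qed
  have "\<not> int d dvd g * q" if "d \<in> D" for d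
  proof
    assume "int d dvd g * q"
    then have "int d dvd g" using 2[OF that] by (simp add: gcd_proj2_if_dvd)
    then have "int d dvd int m" "int d dvd i" using g(1,2) by (meson dvd_trans)+
    \<comment> \<open>\<open>prim\<close> turns \<open>d dvd m\<close> into \<open>d = m\<close>, so
      \<open>m\<close> would divide \<open>i\<close>.\<close>
    then show False using prim[OF that] m(2) by simp
  qed
  then show ?thesis using 1 2 g(2) by (meson dvd_trans)
qed

text \<open>For a common prime factor \<open>p\<close>, the parts of \<open>a\<close> and
  \<open>b\<close> prime to \<open>p\<close> are not multiples of \<open>gcd a b\<close>. Without a
  separating \<open>e\<close> these parts would divide each other and coincide; then
  \<open>a\<close> and \<open>b\<close> would differ only in the power of \<open>p\<close>, and one
  would divide the other.\<close>

lemma ex_divisor_separating: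
  fixes a b :: nat
  assumes "a > 0" "b > 0" "\<not> a dvd b" "\<not> b dvd a" "\<not> coprime a b"
  shows "\<exists>e. (e dvd b \<and> \<not> e dvd a \<or> e dvd a \<and> \<not> e dvd b) \<and> \<not> gcd a b dvd e"
proof (rule ccontr)
  assume "\<not> ?thesis"
  then have no: "\<And>e. e dvd b \<Longrightarrow> \<not> gcd a b dvd e \<Longrightarrow> e dvd a" "\<And>e. e dvd a \<Longrightarrow> \<not> gcd a b dvd e \<Longrightarrow> e dvd b"
    by auto
  obtain p where p: "prime p" "p dvd gcd a b"
    using assms(5) by (metis coprime_iff_gcd_eq_1 prime_factor_nat)
  have "\<exists>k m. n = p ^ k * m \<and> \<not> p dvd m" if "n > 0" for n
    using that p(1) by (metis multiplicity_decompose' not_gr_zero not_prime_unit)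
  then obtain k l a' b' where a': "a = p ^ k * a'" "\<not> p dvd a'" and b': "b = p ^ l * b'" "\<not> p dvd b'"
    using assms(1,2) by metis
  have "coprime (p ^ l) a'" "coprime (p ^ k) b'"
    using a'(2) b'(2) p(1) by (simp_all add: prime_imp_coprime)
  then have cop: "coprime a' (p ^ l)" "coprime b' (p ^ k)" by (simp_all add: ac_simps)
  have "\<not> gcd a b dvd a'" "\<not> gcd a b dvd b'" using a'(2) b'(2) dvd_trans[OF p(2)] by blast+
  moreover have "a' dvd a" "b' dvd b" unfolding a'(1) b'(1) by simp_all
  ultimately have "a' dvd p ^ l * b'" "b' dvd p ^ k * a'" using no unfolding a'(1) b'(1) by blast+
  then have "a' dvd b'" "b' dvd a'" using cop by (simp_all add: coprime_dvd_mult_right_iff)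
  then have eq: "a' = b'" by (rule dvd_antisym)
  have "a dvd b \<or> b dvd a"
    using le_imp_power_dvd[of k l p] le_imp_power_dvd[of l k p] nat_le_linear[of k l]
    unfolding a'(1) b'(1) eq by (auto intro: mult_dvd_mono)
  then show False using assms by blast
qed

section \<open>Topology of configurations\<close>

lemma open_config_cylinder:
  assumes "open (U :: config set)" "x \<in> U"
  shows "\<exists>l::nat. \<forall>y. (\<forall>i\<in>{- int l..int l}. y i = x i) \<longrightarrow> y \<in> U"
proof -
  have "openin (product_topology (\<lambda>i::int. euclidean :: bool topology) UNIV) U"
    using assms(1) by (simp add: euclidean_product_topology)
  from product_topology_open_contains_basis[OF this assms(2)]
  obtain V where V: "x \<in> Pi\<^sub>E UNIV V" "finite {i. V i \<noteq> UNIV}" "Pi\<^sub>E UNIV V \<subseteq> U"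
    by auto
  \<comment> \<open>Inserting 0 keeps the set nonempty when no coordinate is constrained.\<close>
  define l where "l = Max (insert 0 (abs ` {i. V i \<noteq> UNIV}))"
  have l: "l \<ge> 0" "\<bar>i\<bar> \<le> l" if "V i \<noteq> UNIV" for i
    unfolding l_def using V(2) that by (auto intro!: Max_ge)
  have "y \<in> U" if "\<forall>i\<in>{- int (nat l)..int (nat l)}. y i = x i" for y
  proof -
    have "y i \<in> V i" for i
    proof (cases "V i = UNIV")
      case False
      then have "i \<in> {- int (nat l)..int (nat l)}" using l[OF False] by auto
      then have "y i = x i" using that by blast
      then show ?thesis using V(1) by auto
    qed auto
    then show ?thesis using V(3) by auto
  qed
  then show ?thesis by blast
qed

lemma open_config_fixed: "open {y :: config. \<forall>i\<in>{- int l..int l}. y i = x i}"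
proof -
  have "open {y :: config. \<forall>i\<in>{- int l..int l}. y i \<in> {x i}}"
    by (rule product_topology_basis') (auto simp: open_discrete)
  then show ?thesis by simp
qed

text \<open>Tychonoff's theorem over the finite space \<open>bool\<close>.\<close>

lemma compact_config: "compact (UNIV :: config set)"
proof -
  have "compact (UNIV :: bool set)" by (simp add: finite_imp_compact)
  then have "compact_space (product_topology (\<lambda>i::int. euclidean :: bool topology) UNIV)"
    unfolding compact_space_product_topology by (simp add: compact_space_def)
  then show ?thesis
    by (simp add: euclidean_product_topology compact_space_def)
qed

lemma closure_config_cylinder:
  assumes "x \<in> closure (S :: config set)"
  shows "\<exists>y\<in>S. \<forall>i\<in>{- int l..int l}. y i = x i"
proof -
  have "S \<inter> {y. \<forall>i\<in>{- int l..int l}. y i = x i} \<noteq> {}"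
    using assms open_config_fixed[of l x] by (subst (asm) closure_iff_nhds_not_empty) blast
  then show ?thesis by blast
qed

text \<open>The core of the Curtis-Hedlund-Lyndon theorem: continuity into a discrete space gives a
  window at each point, and compactness a common one.\<close>

lemma continuous_on_compact_local:
  fixes f :: "config \<Rightarrow> bool"
  assumes "compact X" "continuous_on X f"
  shows "\<exists>l::nat. \<forall>x\<in>X. \<forall>y\<in>X. (\<forall>i\<in>{- int l..int l}. x i = y i) \<longrightarrow> f x = f y"
proof -
  have "\<exists>l::nat. \<forall>y\<in>X. (\<forall>i\<in>{- int l..int l}. y i = x i) \<longrightarrow> f y = f x" if "x \<in> X" for x
  proof -
    obtain U where U: "open U" "U \<inter> X = f -` {f x} \<inter> X"
      using assms(2) unfolding continuous_on_open_invariant by (meson open_discrete)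
    then have "x \<in> U" using that by blast
    from open_config_cylinder[OF U(1) this] obtain l :: nat
      where l: "\<And>y. \<forall>i\<in>{- int l..int l}. y i = x i \<Longrightarrow> y \<in> U" by blast
    have "f y = f x" if "y \<in> X" "\<forall>i\<in>{- int l..int l}. y i = x i" for y
    proof -
      have "y \<in> U \<inter> X" using l[OF that(2)] that(1) by blast
      then show ?thesis unfolding U(2) by simp
    qed
    then show ?thesis by blast
  qed
  then obtain L :: "config \<Rightarrow> nat" where
    L: "\<And>x y. x \<in> X \<Longrightarrow> y \<in> X \<Longrightarrow> \<forall>i\<in>{- int (L x)..int (L x)}. y i = x i \<Longrightarrow> f y = f x"
    by metis
  let ?U = "\<lambda>x. {y. \<forall>i\<in>{- int (L x)..int (L x)}. y i = x i}"
  obtain T where T: "T \<subseteq> X" "finite T" "X \<subseteq> (\<Union>x\<in>T. ?U x)"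
    by (rule compactE_image[OF assms(1), of X ?U]) (auto intro: open_config_fixed)
  define l where "l = Max (insert 0 (L ` T))"
  have "f x = f y" if xy: "x \<in> X" "y \<in> X" "\<forall>i\<in>{- int l..int l}. x i = y i" for x y
  proof -
    obtain z where z: "z \<in> T" "x \<in> ?U z" using T(3) xy(1) by blast
    then have "L z \<le> l" using T(2) by (auto simp: l_def)
    then have "\<forall>i\<in>{- int (L z)..int (L z)}. y i = z i" using z(2) xy(3) by auto
    then have "f y = f z" using L z(1) T(1) xy(2) by blast
    moreover have "f x = f z" using L z T(1) xy(1) by blast
    ultimately show ?thesis by simp
  qed
  then show ?thesis by blast
qed

section \<open>Consequences of the equality of the two subshifts\<close>

lemma eta_iff: "eta B j \<longleftrightarrow> (\<forall>b\<in>B. \<not> int b dvd j)"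
  by (auto simp: eta_def free_integers_def dvd_def)

lemma ex_eta_occurrence:
  assumes "free_subshift B = admissible_subshift B" "admissible B (support x)"
  shows "\<exists>r. \<forall>i\<in>{- int l..int l}. eta B (i + r) = x i"
proof -
  have "x \<in> free_subshift B" using assms by (simp add: admissible_subshift_def)
  then show ?thesis
    unfolding free_subshift_def using closure_config_cylinder[of x _ l] by (fastforce simp: shift_power_apply)
qed

lemma ex_pattern_realised:
  assumes eq: "free_subshift B = admissible_subshift B" and A: "finite A" "admissible B A"
  shows "\<exists>r. \<forall>a\<in>A. \<forall>b\<in>B. \<not> int b dvd a + r"
proof -
  define l where "l = nat (Max (insert 0 (abs ` A)))"
  have l: "a \<in> {- int l..int l}" if "a \<in> A" for a
  proof -
    have "\<bar>a\<bar> \<le> Max (insert 0 (abs ` A))" using A(1) that by (intro Max_ge) auto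
    then have "\<bar>a\<bar> \<le> int l" unfolding l_def by linarith
    then show ?thesis by (simp add: abs_le_iff)
  qed
  have "admissible B (support (\<lambda>j. j \<in> A))" using A(2) by (simp add: support_def)
  from ex_eta_occurrence[OF eq this, of l]
  obtain r where "\<And>i. i \<in> {- int l..int l} \<Longrightarrow> eta B (i + r) = (i \<in> A)" by blast
  then show ?thesis using l by (meson eta_iff)
qed

text \<open>The zero configuration is admissible, so \<open>eta B\<close> has arbitrarily long runs
  of zeros. For finite \<open>B\<close> it would be periodic with a one at position 1.\<close>

lemma sieve_infinite:
  assumes B: "0 \<notin> B" "1 \<notin> B" and eq: "free_subshift B = admissible_subshift B"
  shows "infinite B"
proof
  assume fin: "finite B"
  let ?m = "int (\<Prod>B)"
  have m: "?m > 0" using B(1) by (auto intro!: prod_pos gr0I)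
  have "admissible B (support (\<lambda>_. False))" using B(1) by (auto simp: admissible_def support_def intro: gr0I)
  from ex_eta_occurrence[OF eq this, of "\<Prod>B"]
  obtain r where r: "\<And>i. i \<in> {- ?m..?m} \<Longrightarrow> \<not> eta B (i + r)" by blast
  \<comment> \<open>This makes \<open>?i + r\<close> congruent to 1 modulo the product of
    \<open>B\<close>, so an element of \<open>B\<close> dividing it would divide 1.\<close>
  let ?i = "(1 - r) mod ?m"
  have "0 \<le> ?i" "?i < ?m" using m by auto
  then have "\<not> eta B (?i + r)" by (intro r) auto
  then obtain b where b: "b \<in> B" "int b dvd ?i + r" by (auto simp: eta_iff)
  have "int b dvd ?m" using b(1) fin by (simp add: dvd_prodI)
  moreover have "?m dvd ?i - (1 - r)" by (metis cong_def cong_iff_dvd_diff mod_mod_trivial)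
  ultimately have "int b dvd ?i - (1 - r)" by (rule dvd_trans)
  then have "int b dvd (?i + r) - (?i - (1 - r))" using b(2) by (rule dvd_diff[rotated])
  then have "b = 1" by simp
  then show False using b(1) B(2) by simp
qed

text \<open>The finite set below misses the class 0 modulo every \<open>d \<noteq> b\<close> and only the class \<open>e\<close>
  modulo \<open>b\<close>, while 0 is the only class modulo \<open>a\<close> that it misses. A translation realising it
  would need \<open>- r \<equiv> e\<close> modulo \<open>b\<close> and \<open>r \<equiv> 0\<close> modulo \<open>a\<close>.\<close>

lemma no_separating_divisor:
  fixes B :: "nat set"
  assumes B0: "0 \<notin> B" and prim: "primitive B"
    and real: "\<And>A. finite A \<Longrightarrow> admissible B A \<Longrightarrow> \<exists>r. \<forall>a\<in>A. \<forall>b\<in>B. \<not> int b dvd a + r"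
    and ab: "a \<in> B" "b \<in> B" "a \<noteq> b" and e: "e dvd b" "\<not> e dvd a" "\<not> gcd a b dvd e"
  shows False
proof -
  have pr: "d \<in> B \<Longrightarrow> d' \<in> B \<Longrightarrow> d dvd d' \<Longrightarrow> d = d'" for d d'
    using prim unfolding primitive_def by blast
  have pos: "a > 0" "b > 0" using ab B0 by (metis gr0I)+
  \<comment> \<open>The set \<open>?F\<close> below has at most \<open>a + b\<close> elements, so
    larger moduli miss a class automatically.\<close>
  define D where "D = {d\<in>B. d \<le> a + b}"
  have D: "finite D" "0 \<notin> D" "a \<in> D" "b \<in> D" using B0 ab by (auto simp: D_def)
  have "\<exists>n. [n = j] (mod int b) \<and> (\<forall>d\<in>D - {b}. \<not> int d dvd n)" for j
  proof (cases "int b dvd j")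
    case True
    then show ?thesis using pr ab(2)
      by (intro exI[of _ "int b"]) (auto simp: D_def cong_iff_dvd_diff)
  next
    case False
    then show ?thesis
      using ex_cong_not_multiple[OF D(1,2) pos(2) False] pr ab(2) D_def by blast
  qed
  then obtain f where f: "\<And>j. [f j = j] (mod int b)" "\<And>j d. d \<in> D \<Longrightarrow> d \<noteq> b \<Longrightarrow> \<not> int d dvd f j"
    by (metis Diff_iff singletonD)
  have "\<exists>n. [n = i] (mod int a) \<and> (\<forall>d\<in>D. \<not> int d dvd n) \<and> \<not> [n = int e] (mod int b)"
    if i: "\<not> int a dvd i" for i
  proof -
    obtain n where n: "[n = i] (mod int a)" "\<forall>d\<in>D. \<not> int d dvd n \<and> gcd n (int d) dvd int a"
      using ex_cong_not_multiple[OF D(1,2) pos(1) i] pr ab(1) D_def by blast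
    \<comment> \<open>Otherwise \<open>e\<close>, a divisor of \<open>b\<close>, would divide
      \<open>n\<close> and so \<open>gcd n b\<close>, which divides \<open>a\<close>.\<close>
    have "\<not> [n = int e] (mod int b)"
    proof
      assume "[n = int e] (mod int b)"
      then have "int b dvd n - int e" by (simp add: cong_iff_dvd_diff)
      then have "int e dvd n - int e" using e(1) by (meson dvd_trans int_dvd_int_iff)
      then have "int e dvd n" by (metis dvd_add dvd_refl diff_add_cancel)
      then have "int e dvd gcd n (int b)" using e(1) by simp
      then have "int e dvd int a" using n(2) D(4) by (meson dvd_trans)
      then show False using e(2) by simp
    qed
    then show ?thesis using n by blast
  qed
  then obtain g where g: "\<And>i. \<not> int a dvd i \<Longrightarrow> [g i = i] (mod int a)"
    "\<And>i d. \<not> int a dvd i \<Longrightarrow> d \<in> D \<Longrightarrow> \<not> int d dvd g i"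
    "\<And>i. \<not> int a dvd i \<Longrightarrow> \<not> [g i = int e] (mod int b)"
    by metis
  let ?J = "{0..<int b} \<inter> {j. \<not> [j = int e] (mod int b)}" and ?I = "{1..<int a}"
  let ?F = "f ` ?J \<union> g ` ?I"
  have I: "\<not> int a dvd i" if "i \<in> ?I" for i using that by (auto dest: zdvd_imp_le)
  have fin: "finite ?F" by auto
  have "card ?J \<le> b" using card_mono[of "{0..<int b}" ?J] by auto
  then have "card (f ` ?J) \<le> b" using card_image_le[of ?J f] by auto
  moreover have "card (g ` ?I) \<le> a" using card_image_le[of ?I g] by auto
  ultimately have card: "card ?F \<le> a + b" using card_Un_le[of "f ` ?J" "g ` ?I"] by linarith
  have "admissible B ?F"
    unfolding admissible_iff_missed_class[OF B0]
  proof
    fix d assume d: "d \<in> B"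
    consider "d = b" | "d \<in> D" "d \<noteq> b" | "d > a + b" using d unfolding D_def by fastforce
    then show "\<exists>c. \<forall>x\<in>?F. \<not> [x = c] (mod int d)"
    proof cases
      case 1
      have "\<not> [f j = int e] (mod int b)" if "j \<in> ?J" for j
        using f(1)[of j] that by (auto intro: cong_trans cong_sym)
      then show ?thesis using g(3) I unfolding 1 by blast
    next
      case 2
      then show ?thesis using f(2) g(2) I by (intro exI[of _ 0]) (auto simp: cong_0_iff)
    next
      case 3
      then show ?thesis using fin card by (intro small_set_misses_class) auto
    qed
  qed
  then obtain r where r: "\<And>x d. x \<in> ?F \<Longrightarrow> d \<in> B \<Longrightarrow> \<not> int d dvd x + r"
    using real[OF fin] by blast
  have "[- r = int e] (mod int b)"
  proof (rule ccontr)
    assume not: "\<not> ?thesis"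
    let ?j = "(- r) mod int b"
    have "?j \<in> ?J" using not pos(2) by (auto simp: cong_def)
    then have "\<not> int b dvd f ?j + r" using r ab(2) by blast
    moreover have "[f ?j = - r] (mod int b)" using f(1)[of ?j] by (simp add: cong_def)
    ultimately show False by (simp add: cong_iff_dvd_diff)
  qed
  moreover have "int a dvd r"
  proof (rule ccontr)
    assume not: "\<not> ?thesis"
    let ?i = "(- r) mod int a"
    have "?i \<noteq> 0" using not by (metis dvd_eq_mod_eq_0 dvd_minus_iff)
    moreover have "0 \<le> ?i" "?i < int a" using pos(1) by auto
    ultimately have i: "?i \<in> ?I" by auto
    then have "\<not> int a dvd g ?i + r" using r ab(1) by blast
    moreover have "[g ?i = - r] (mod int a)" using g(1)[OF I[OF i]] by (simp add: cong_def)
    ultimately show False by (simp add: cong_iff_dvd_diff)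
  qed
  \<comment> \<open>Modulo \<open>gcd a b\<close> the two congruences together force
    \<open>e\<close> to be 0.\<close>
  ultimately have "int (gcd a b) dvd - r - int e" "int (gcd a b) dvd r"
    by (meson cong_iff_dvd_diff dvd_trans gcd_dvd1 gcd_dvd2 int_dvd_int_iff)+
  then have "int (gcd a b) dvd (- r - int e) + r" by (rule dvd_add)
  then show False using e(3) by simp
qed

lemma sieve_coprime:
  assumes B0: "0 \<notin> B" and prim: "primitive B"
    and real: "\<And>A. finite A \<Longrightarrow> admissible B A \<Longrightarrow> \<exists>r. \<forall>a\<in>A. \<forall>b\<in>B. \<not> int b dvd a + r"
    and ab: "a \<in> B" "b \<in> B" "a \<noteq> b"
  shows "coprime a b"
proof (rule ccontr)
  assume nc: "\<not> coprime a b"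
  have "a > 0" "b > 0" using ab B0 by (metis gr0I)+
  moreover have "\<not> a dvd b" "\<not> b dvd a" using prim ab unfolding primitive_def by blast+
  ultimately obtain e where
    "(e dvd b \<and> \<not> e dvd a \<or> e dvd a \<and> \<not> e dvd b) \<and> \<not> gcd a b dvd e"
    using ex_divisor_separating nc by blast
  then show False
    using no_separating_divisor[OF B0 prim real ab, of e]
      no_separating_divisor[OF B0 prim real ab(2,1) ab(3)[symmetric], of e]
    by (auto simp: gcd.commute)
qed

section \<open>Admissible sets for infinite pairwise coprime moduli\<close>

lemma chinese_remainder_int_gt:
  fixes c :: "nat \<Rightarrow> int" and N :: int
  assumes D: "finite D" "0 \<notin> D" and cop: "\<And>a b. a \<in> D \<Longrightarrow> b \<in> D \<Longrightarrow> a \<noteq> b \<Longrightarrow> coprime a b"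
  shows "\<exists>n>N. \<forall>d\<in>D. [n = c d] (mod int d)"
proof -
  obtain x where x: "\<And>d. d \<in> D \<Longrightarrow> [x = nat (c d mod int d)] (mod d)"
    using chinese_remainder_nat[of D "\<lambda>d. d" "\<lambda>d. nat (c d mod int d)"] D(1) cop by auto
  have x': "[int x = c d] (mod int d)" if "d \<in> D" for d
  proof -
    have "d > 0" using that D(2) by (metis gr0I)
    then have "int (nat (c d mod int d)) = c d mod int d" by simp
    moreover have "[int x = int (nat (c d mod int d))] (mod int d)"
      using x[OF that] by (simp only: cong_int_iff)
    ultimately show ?thesis by (simp add: cong_def)
  qed
  \<comment> \<open>Multiples of the product preserve all residues; the factor pushes the solution
    past \<open>N\<close>.\<close>
  let ?n = "int x + (\<bar>N\<bar> + 1) * int (\<Prod>D)"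
  have "int (\<Prod>D) > 0" using D(2) by (auto intro!: prod_pos gr0I)
  then have "\<bar>N\<bar> + 1 \<le> (\<bar>N\<bar> + 1) * int (\<Prod>D)" by (intro mult_le_cancel_left1[THEN iffD2]) auto
  then have "?n > N" using abs_ge_self[of N] of_nat_0_le_iff[of x, where 'a = int] by (smt (verit))
  moreover have "[?n = c d] (mod int d)" if "d \<in> D" for d
  proof -
    have "int d dvd (\<bar>N\<bar> + 1) * int (\<Prod>D)" using that D(1) by (intro dvd_mult) (simp add: dvd_prodI)
    then have "[?n = int x] (mod int d)" by (simp add: cong_iff_dvd_diff)
    then show ?thesis using x'[OF that] by (rule cong_trans)
  qed
  ultimately show ?thesis by blast
qed

text \<open>From here on these properties, together with closedness, replace the equality of the two
  subshifts.\<close>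

locale coprime_sieve =
  fixes B :: "nat set"
  assumes gt_1: "b \<in> B \<Longrightarrow> b > 1"
    and coprime: "a \<in> B \<Longrightarrow> b \<in> B \<Longrightarrow> a \<noteq> b \<Longrightarrow> coprime a b"
    and infinite: "infinite B"
begin

lemma zero_notin: "0 \<notin> B"
  using gt_1 by force

lemma adm_iff: "admissible B A \<longleftrightarrow> (\<forall>b\<in>B. \<exists>c. \<forall>a\<in>A. \<not> [a = c] (mod int b))"
  by (rule admissible_iff_missed_class[OF zero_notin])

lemma adm_mono: "admissible B A \<Longrightarrow> A' \<subseteq> A \<Longrightarrow> admissible B A'"
  by (rule admissible_mono[OF zero_notin])

lemma ex_large: "\<exists>b\<in>B. b > N"
  using infinite infinite_nat_iff_unbounded by blast

text \<open>For a small modulus \<open>d\<close> other than \<open>b\<close>, choose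
  \<open>n\<close> so that the class missed by \<open>C\<close> is moved onto the one missed by
  \<open>A\<close>. At \<open>b\<close> the residue of \<open>n\<close> is prescribed, and
  \<open>c\<close> is missed by hypothesis. Large moduli exceed the number of points.\<close>

lemma ex_translate_admissible:
  assumes fin: "finite A" "finite C" and adm: "admissible B A" "admissible B C" and b: "b \<in> B"
    and A: "\<And>a. a \<in> A \<Longrightarrow> \<not> [a = c] (mod int b)" and C: "\<And>a. a \<in> C \<Longrightarrow> \<not> [i + a = c] (mod int b)"
  shows "\<exists>n>N. [n = i] (mod int b) \<and> admissible B (A \<union> (+) n ` C)"
proof -
  obtain \<alpha> \<gamma> where \<alpha>: "\<And>d a. d \<in> B \<Longrightarrow> a \<in> A \<Longrightarrow> \<not> [a = \<alpha> d] (mod int d)"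
    and \<gamma>: "\<And>d a. d \<in> B \<Longrightarrow> a \<in> C \<Longrightarrow> \<not> [a = \<gamma> d] (mod int d)"
    using adm unfolding adm_iff by metis
  \<comment> \<open>The summand \<open>b\<close> ensures that \<open>b\<close> itself is in
    \<open>D\<close>.\<close>
  define D where "D = {d\<in>B. d \<le> card A + card C + b}"
  have D: "finite D" "0 \<notin> D" "b \<in> D" using b zero_notin by (auto simp: D_def)
  obtain n where n: "n > N" "\<And>d. d \<in> D \<Longrightarrow> [n = (if d = b then i else \<alpha> d - \<gamma> d)] (mod int d)"
    using chinese_remainder_int_gt[OF D(1,2), of N "\<lambda>d. if d = b then i else \<alpha> d - \<gamma> d"] coprime D_def
    by blast
  have ni: "[n = i] (mod int b)" using n(2)[OF D(3)] by simp
  have "admissible B (A \<union> (+) n ` C)"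
    unfolding adm_iff
  proof
    fix d assume d: "d \<in> B"
    consider "d = b" | "d \<in> D" "d \<noteq> b" | "d > card A + card C" using d unfolding D_def by fastforce
    then show "\<exists>c. \<forall>a\<in>A \<union> (+) n ` C. \<not> [a = c] (mod int d)"
    proof cases
      case 1
      have "\<not> [n + a = c] (mod int b)" if "a \<in> C" for a
        using C[OF that] ni by (meson cong_add cong_refl cong_sym cong_trans)
      then show ?thesis unfolding 1 using A by blast
    next
      case 2
      then have nd: "[n = \<alpha> d - \<gamma> d] (mod int d)" using n(2)[of d] by simp
      have "\<not> [n + a = \<alpha> d] (mod int d)" if "a \<in> C" for a
      proof
        assume "[n + a = \<alpha> d] (mod int d)"
        then have "[n + a - n = \<alpha> d - (\<alpha> d - \<gamma> d)] (mod int d)" using nd by (rule cong_diff)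
        then show False using \<gamma>[OF d that] by simp
      qed
      then show ?thesis using \<alpha>[OF d] by blast
    next
      case 3
      have "card (A \<union> (+) n ` C) \<le> card A + card C"
        using card_Un_le[of A "(+) n ` C"] card_image_le[OF fin(2), of "(+) n"] by linarith
      then show ?thesis using fin 3 by (intro small_set_misses_class) auto
    qed
  qed
  then show ?thesis using n(1) ni by blast
qed

text \<open>The patterns are added one at a time. The union keeps missing the class \<open>c\<close>
  modulo \<open>b\<close>, so the translation lemma applies again at each stage.\<close>

lemma ex_packing:
  fixes i :: "'i \<Rightarrow> int" and N :: int
  assumes I: "finite I" and A: "finite A" "admissible B A" and b: "b \<in> B"
    and Ac: "\<And>a. a \<in> A \<Longrightarrow> \<not> [a = c] (mod int b)"
    and C: "\<And>k. k \<in> I \<Longrightarrow> finite (C k)" "\<And>k. k \<in> I \<Longrightarrow> admissible B (C k)"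
      "\<And>k a. k \<in> I \<Longrightarrow> a \<in> C k \<Longrightarrow> \<not> [i k + a = c] (mod int b)"
  shows "\<exists>n. (\<forall>k\<in>I. n k > N \<and> [n k = i k] (mod int b)) \<and>
    (\<forall>k\<in>I. \<forall>k'\<in>I. k \<noteq> k' \<longrightarrow> \<bar>n k - n k'\<bar> > N) \<and>
    admissible B (A \<union> (\<Union>k\<in>I. (+) (n k) ` C k))"
  using I C
proof (induction I rule: finite_induct)
  case empty
  then show ?case using A(2) by simp
next
  case (insert k I)
  then obtain n where n: "\<forall>k\<in>I. n k > N \<and> [n k = i k] (mod int b)"
    "\<forall>k\<in>I. \<forall>k'\<in>I. k \<noteq> k' \<longrightarrow> \<bar>n k - n k'\<bar> > N"
    "admissible B (A \<union> (\<Union>k\<in>I. (+) (n k) ` C k))"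
    by (metis (no_types, lifting) insertI2)
  let ?A = "A \<union> (\<Union>k\<in>I. (+) (n k) ` C k)"
  have fin: "finite ?A" using A(1) insert by auto
  have Ac': "\<not> [a = c] (mod int b)" if a: "a \<in> ?A" for a
  proof (cases "a \<in> A")
    case False
    then obtain k' x where k': "k' \<in> I" "x \<in> C k'" "a = n k' + x" using a by blast
    then have "[a = i k' + x] (mod int b)" using n(1) by (simp add: cong_add_rcancel)
    then show ?thesis using insert.prems(3)[of k' x] k' by (meson cong_sym cong_trans insertI2)
  qed (use Ac in auto)
  \<comment> \<open>A position beyond \<open>M\<close> is more than \<open>N\<close> away from all
    earlier ones.\<close>
  obtain M where M: "M \<ge> N" "\<And>k'. k' \<in> I \<Longrightarrow> M \<ge> n k' + N"
  proof
    show "Max (insert N ((\<lambda>k'. n k' + N) ` I)) \<ge> N" using insert.hyps by simp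
    show "Max (insert N ((\<lambda>k'. n k' + N) ` I)) \<ge> n k' + N" if "k' \<in> I" for k'
      using insert.hyps that by (intro Max_ge) auto
  qed
  obtain m where m: "m > M" "[m = i k] (mod int b)" "admissible B (?A \<union> (+) m ` C k)"
    using ex_translate_admissible[OF fin _ n(3) _ b Ac', of "C k" "i k" M] insert.prems by blast
  let ?n = "n(k := m)"
  have old: "?n k' = n k'" if "k' \<in> I" for k' using that insert.hyps by auto
  have "(\<Union>k\<in>insert k I. (+) (?n k) ` C k) = (\<Union>k\<in>I. (+) (n k) ` C k) \<union> (+) m ` C k"
    using insert.hyps by (auto simp: old)
  then have "admissible B (A \<union> (\<Union>k\<in>insert k I. (+) (?n k) ` C k))" using m(3) by (simp add: Un_assoc)
  moreover have "\<forall>k'\<in>insert k I. ?n k' > N \<and> [?n k' = i k'] (mod int b)"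
    using n(1) m(1,2) M(1) by auto
  moreover have "\<bar>m - n k'\<bar> > N" "\<bar>n k' - m\<bar> > N" if "k' \<in> I" for k'
    using M(2)[OF that] m(1) by linarith+
  then have "\<forall>k1\<in>insert k I. \<forall>k2\<in>insert k I. k1 \<noteq> k2 \<longrightarrow> \<bar>?n k1 - ?n k2\<bar> > N"
    using n(2) by auto
  ultimately show ?case by blast
qed

text \<open>For \<open>b\<close> larger than every distance from \<open>j\<close> to
  \<open>A\<close>, the set \<open>A\<close> misses the class of \<open>j\<close> modulo
  \<open>b\<close>. Far points in all the other classes leave that class as the only one an
  admissible superset can miss.\<close>

lemma ex_admissible_excluding_one:
  assumes A: "finite A" "admissible B A" "j \<notin> A"
  shows "\<exists>F. finite F \<and> admissible B F \<and> A \<subseteq> F \<and> F - A \<subseteq> {N<..} \<and>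
    (\<forall>G. admissible B G \<and> F \<subseteq> G \<longrightarrow> j \<notin> G)"
proof -
  obtain b where b: "b \<in> B" "b > nat (Max (insert 0 ((\<lambda>a. \<bar>a - j\<bar>) ` A)))" using ex_large by blast
  have Aj: "\<not> [a = j] (mod int b)" if "a \<in> A" for a
  proof
    assume "[a = j] (mod int b)"
    then have "int b dvd \<bar>a - j\<bar>" by (simp add: cong_iff_dvd_diff)
    moreover have "\<bar>a - j\<bar> > 0" using that A(3) by auto
    ultimately have "int b \<le> \<bar>a - j\<bar>" by (rule zdvd_imp_le)
    moreover have "\<bar>a - j\<bar> \<le> Max (insert 0 ((\<lambda>a. \<bar>a - j\<bar>) ` A))" using A(1) that by (intro Max_ge) auto
    ultimately show False using b(2) by linarith
  qed
  let ?I = "{0..<int b} \<inter> {i. \<not> [i = j] (mod int b)}"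
  have sing: "admissible B {0}" using gt_1 by (auto simp: admissible_def)
  obtain n where n: "\<forall>k\<in>?I. n k > N \<and> [n k = k] (mod int b)"
    "admissible B (A \<union> (\<Union>k\<in>?I. (+) (n k) ` {0}))"
    using ex_packing[OF _ A(1,2) b(1) Aj, of ?I "\<lambda>_. {0}" "\<lambda>k. k" N] sing by auto
  let ?F = "A \<union> (\<Union>k\<in>?I. (+) (n k) ` {0})"
  have "j \<notin> G" if G: "admissible B G" "?F \<subseteq> G" for G
  proof
    assume j: "j \<in> G"
    obtain c where c: "\<forall>a\<in>G. \<not> [a = c] (mod int b)" using G(1) b(1) adm_iff by blast
    have "b > 0" using gt_1[OF b(1)] by simp
    then have "c mod int b \<in> {0..<int b}" "[c mod int b = c] (mod int b)" by (auto simp: cong_def)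
    moreover have "\<not> [c = j] (mod int b)" using c j cong_sym by blast
    ultimately have k: "c mod int b \<in> ?I" by (auto simp: cong_def)
    then have "n (c mod int b) \<in> G" using G(2) by force
    moreover have "[n (c mod int b) = c] (mod int b)" using n(1) k by (simp add: cong_def)
    ultimately show False using c by blast
  qed
  moreover have "?F - A \<subseteq> {N<..}" using n(1) by auto
  moreover have "finite ?F" using A(1) by auto
  ultimately show ?thesis using n(2) by blast
qed

text \<open>The points of \<open>J\<close> are excluded one by one. Added points lie beyond
  \<open>N\<close>, hence outside \<open>J\<close>, and earlier exclusions persist for larger
  sets.\<close>

lemma ex_admissible_excluding:
  assumes A: "finite A" "admissible B A" and J: "finite J" "J \<inter> A = {}" "J \<subseteq> {..N}"
  shows "\<exists>F. finite F \<and> admissible B F \<and> A \<subseteq> F \<and> F - A \<subseteq> {N<..} \<and>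
    (\<forall>G. admissible B G \<and> F \<subseteq> G \<longrightarrow> J \<inter> G = {})"
  using J
proof (induction J rule: finite_induct)
  case empty
  then show ?case using A by blast
next
  case (insert j J)
  then obtain F where F: "finite F" "admissible B F" "A \<subseteq> F" "F - A \<subseteq> {N<..}"
    "\<forall>G. admissible B G \<and> F \<subseteq> G \<longrightarrow> J \<inter> G = {}" by auto
  have "j \<notin> F" using insert.prems F(4) by force
  from ex_admissible_excluding_one[OF F(1,2) this, of N]
  obtain F' where F': "finite F'" "admissible B F'" "F \<subseteq> F'" "F' - F \<subseteq> {N<..}"
    "\<forall>G. admissible B G \<and> F' \<subseteq> G \<longrightarrow> j \<notin> G" by blast
  have "F' - A \<subseteq> {N<..}" using F(4) F'(4) by blast
  moreover have "\<forall>G. admissible B G \<and> F' \<subseteq> G \<longrightarrow> insert j J \<inter> G = {}"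
    using F(5) F'(3,5) by blast
  ultimately show ?case using F(3) F' by blast
qed

end

section \<open>Cellular automata\<close>

lemma shift_power_add: "shift_power m (shift_power n x) = shift_power (m + n) x"
  by (rule ext) (simp add: shift_power_apply algebra_simps)

lemma shift_power_0 [simp]: "shift_power 0 x = x"
  by (simp add: shift_power_def)

lemma shift_eq_shift_power: "shift x = shift_power 1 x"
  by (rule ext) (simp add: shift_power_apply shift_def)

lemma support_indicator [simp]: "support (\<lambda>j. j \<in> A) = A"
  by (simp add: support_def)

lemma block_0: "block x n l 0 = x n"
  by (simp add: block_def)

section \<open>Heredity and shift invariance of the admissible subshift\<close>

context coprime_sieve
begin

abbreviation "X \<equiv> admissible_subshift B"

lemma mem_X: "x \<in> X \<longleftrightarrow> admissible B (support x)"
  by (simp add: admissible_subshift_def)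

lemma X_downward: "x \<in> X \<Longrightarrow> (\<And>j. y j \<Longrightarrow> x j) \<Longrightarrow> y \<in> X"
  unfolding mem_X by (rule adm_mono) (auto simp: support_def)

lemma shift_power_in_X: "x \<in> X \<Longrightarrow> shift_power n x \<in> X"
  unfolding mem_X adm_iff
proof
  fix b assume "b \<in> B" and "\<forall>b\<in>B. \<exists>c. \<forall>a\<in>support x. \<not> [a = c] (mod int b)"
  then obtain c where c: "\<forall>a\<in>support x. \<not> [a = c] (mod int b)" by blast
  have "\<not> [a = c - n] (mod int b)" if "a \<in> support (shift_power n x)" for a
  proof
    assume "[a = c - n] (mod int b)"
    then have "[a + n = c - n + n] (mod int b)" by (rule cong_add) simp
    moreover have "a + n \<in> support x" using that by (simp add: support_def shift_power_apply)
    ultimately show False using c by simp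
  qed
  then show "\<exists>c. \<forall>a\<in>support (shift_power n x). \<not> [a = c] (mod int b)" by blast
qed

lemma equivariant_shift_power:
  assumes range: "\<And>x. x \<in> X \<Longrightarrow> \<tau> x \<in> X" and shift: "\<And>x. x \<in> X \<Longrightarrow> \<tau> (shift x) = shift (\<tau> x)"
    and x: "x \<in> X"
  shows "\<tau> (shift_power n x) = shift_power n (\<tau> x)"
proof -
  have nat: "\<tau> (shift_power (int k) x) = shift_power (int k) (\<tau> x)" if "x \<in> X" for k x
  proof (induction k)
    case (Suc k)
    have "\<tau> (shift_power (1 + int k) x) = shift (\<tau> (shift_power (int k) x))"
      using shift[OF shift_power_in_X[OF that]] by (simp add: shift_eq_shift_power shift_power_add)
    then show ?case using Suc by (simp add: shift_eq_shift_power shift_power_add)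
  qed simp
  show ?thesis
  proof (cases "n \<ge> 0")
    case True
    then show ?thesis using nat[OF x, of "nat n"] by simp
  next
    case False
    \<comment> \<open>The nonnegative case is applied to the configuration
      \<open>shift_power n x\<close>.\<close>
    then have "\<tau> x = shift_power (- n) (\<tau> (shift_power n x))"
      using nat[OF shift_power_in_X[OF x], of "nat (- n)" n] by (simp add: shift_power_add)
    then show ?thesis by (simp add: shift_power_add)
  qed
qed

lemma ex_not_in_support:
  assumes "x \<in> X" "b \<in> B"
  shows "\<exists>c. \<forall>j. [j = c] (mod int b) \<longrightarrow> \<not> x j"
  using assms unfolding mem_X adm_iff support_def by blast

end

text \<open>The local form of a cellular automaton. Locality is required at the origin only, since
  equivariance carries it to every coordinate.\<close>

locale sieve_automaton = coprime_sieve +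
  fixes \<tau> :: "config \<Rightarrow> config" and l :: nat
  assumes range: "x \<in> X \<Longrightarrow> \<tau> x \<in> X"
    and equivariant: "x \<in> X \<Longrightarrow> \<tau> (shift_power n x) = shift_power n (\<tau> x)"
    and local: "x \<in> X \<Longrightarrow> y \<in> X \<Longrightarrow> \<forall>i\<in>{- int l..int l}. x i = y i \<Longrightarrow> \<tau> x 0 = \<tau> y 0"
begin

lemma eval_at: "x \<in> X \<Longrightarrow> \<tau> x n = \<tau> (shift_power n x) 0"
  by (simp add: equivariant shift_power_apply)

lemma local_at:
  assumes "x \<in> X" "y \<in> X" "\<forall>i\<in>{- int l..int l}. x (n + i) = y (m + i)"
  shows "\<tau> x n = \<tau> y m"
  unfolding eval_at[OF assms(1)] eval_at[OF assms(2)]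
  using assms by (intro local shift_power_in_X) (auto simp: shift_power_apply add.commute)

lemma local_truncate:
  assumes "x \<in> X"
  shows "\<tau> (\<lambda>j. j \<in> {j\<in>{- int l..int l}. x j}) 0 = \<tau> x 0"
  by (rule local) (auto intro: X_downward[OF assms] assms)

text \<open>By locality any \<open>x\<close> with central block \<open>C\<close> yields the same
  value; blocks that do not occur get the value \<open>False\<close>.\<close>

lemma given_by_local_code: "given_by_code X l (\<lambda>C. \<exists>x\<in>X. block x 0 l = C \<and> \<tau> x 0) \<tau>"
  unfolding given_by_code_def
proof (intro ballI allI)
  fix x n assume x: "x \<in> X"
  have "\<tau> x n = \<tau> y 0" if y: "y \<in> X" "block y 0 l = block x n l" for y
  proof (rule local_at[OF x y(1)], rule ballI)
    fix i assume "i \<in> {- int l..int l}"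
    then show "x (n + i) = y (0 + i)" using fun_cong[OF y(2), of i] by (simp add: block_def)
  qed
  moreover have "block (shift_power n x) 0 l = block x n l"
    by (simp add: block_def shift_power_apply add.commute)
  ultimately show "\<tau> x n = (\<exists>y\<in>X. block y 0 l = block x n l \<and> \<tau> y 0)"
    using shift_power_in_X[OF x] eval_at[OF x] by metis
qed

text \<open>If no coordinate were forced, then for every \<open>t\<close> some block \<open>C t\<close> with a hole at \<open>t\<close> would
  have image 1. Placing a block with the appropriate hole at one site of each class modulo a large
  \<open>b\<close> keeps the class 0 empty in the input, while the output meets every class modulo \<open>b\<close>.\<close>

lemma ex_forced_coordinate: "\<exists>t. \<forall>x\<in>X. \<tau> x 0 \<longrightarrow> x t"
proof (rule ccontr)
  assume "\<not> ?thesis"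
  then obtain y where y: "\<And>t. y t \<in> X" "\<And>t. \<tau> (y t) 0" "\<And>t. \<not> y t t" by metis
  define C where "C t = {j\<in>{- int l..int l}. y t j}" for t
  have fin: "finite (C t)" for t
    by (rule finite_subset[of _ "{- int l..int l}"]) (auto simp: C_def)
  have CX: "(\<lambda>j. j \<in> C t) \<in> X" for t by (rule X_downward[OF y(1)[of t]]) (simp add: C_def)
  then have adm: "admissible B (C t)" for t by (simp add: mem_X)
  have \<tau>C: "\<tau> (\<lambda>j. j \<in> C t) 0" for t using local_truncate[OF y(1)] y(2) by (simp add: C_def)
  \<comment> \<open>Window offsets differ by at most \<open>2 * l\<close>, so they are congruent
    modulo \<open>b\<close> only if equal.\<close>
  obtain b where b: "b \<in> B" "b > 2 * l + 1" using ex_large by blast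
  \<comment> \<open>The only window offset at which a block placed at \<open>k\<close> could meet
    the class 0. If there is none, the value is arbitrary and nothing has to be avoided.\<close>
  define T where "T k = (SOME t. t \<in> {- int l..int l} \<and> int b dvd k + t)" for k
  have avoid: "\<not> [k + a = 0] (mod int b)" if a: "a \<in> C (T k)" for k a
  proof
    assume "[k + a = 0] (mod int b)"
    then have ka: "int b dvd k + a" by (simp add: cong_0_iff)
    have al: "a \<in> {- int l..int l}" using a by (simp add: C_def)
    have "T k \<in> {- int l..int l} \<and> int b dvd k + T k"
      unfolding T_def by (rule someI[of _ a]) (use ka al in blast)
    then have "int b dvd (k + a) - (k + T k)" and less: "\<bar>a - T k\<bar> < int b"
      using ka al b(2) by (blast intro: dvd_diff, auto)
    then have "int b dvd \<bar>a - T k\<bar>" by simp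
    then have "a = T k" using less zdvd_not_zless[of "\<bar>a - T k\<bar>" "int b"] by auto
    then show False using a y(3) by (simp add: C_def)
  qed
  let ?I = "{0..<int b}"
  \<comment> \<open>Sites more than \<open>2 * l\<close> apart have disjoint windows, so the union
    shows exactly \<open>C (T k)\<close> around \<open>n k\<close>.\<close>
  obtain n where n: "\<forall>k\<in>?I. n k > 2 * int l \<and> [n k = k] (mod int b)"
    "\<forall>k\<in>?I. \<forall>k'\<in>?I. k \<noteq> k' \<longrightarrow> \<bar>n k - n k'\<bar> > 2 * int l"
    "admissible B ({} \<union> (\<Union>k\<in>?I. (+) (n k) ` C (T k)))"
    using ex_packing[of ?I "{}" b 0 "\<lambda>k. C (T k)" "\<lambda>k. k" "2 * int l"] fin adm b(1) avoid
      adm_mono[OF adm, of "{}"] by auto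
  define U where "U = (\<Union>k\<in>?I. (+) (n k) ` C (T k))"
  have "admissible B U" using n(3) by (simp add: U_def)
  then have UX: "(\<lambda>j. j \<in> U) \<in> X" by (simp add: mem_X)
  have "\<tau> (\<lambda>j. j \<in> U) (n k)" if k: "k \<in> ?I" for k
  proof -
    have "n k + i \<in> U \<longleftrightarrow> 0 + i \<in> C (T k)" if i: "i \<in> {- int l..int l}" for i
    proof
      assume "n k + i \<in> U"
      then obtain k' a where k': "k' \<in> ?I" "a \<in> C (T k')" "n k + i = n k' + a"
        unfolding U_def by blast
      moreover have "a \<in> {- int l..int l}" using k'(2) by (simp add: C_def)
      ultimately have "\<bar>n k - n k'\<bar> \<le> 2 * int l" using i by auto
      then have "k = k'" using n(2) k k'(1) by fastforce
      then show "0 + i \<in> C (T k)" using k' by simp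
    next
      assume "0 + i \<in> C (T k)"
      then show "n k + i \<in> U" using k unfolding U_def by auto
    qed
    then have "\<tau> (\<lambda>j. j \<in> U) (n k) = \<tau> (\<lambda>j. j \<in> C (T k)) 0" using UX CX by (intro local_at) auto
    then show ?thesis using \<tau>C by simp
  qed
  moreover obtain c where c: "\<And>j. [j = c] (mod int b) \<Longrightarrow> \<not> \<tau> (\<lambda>j. j \<in> U) j"
    using ex_not_in_support[OF range[OF UX] b(1)] by blast
  moreover have "c mod int b \<in> ?I" using b(2) by simp
  moreover have "[n (c mod int b) = c] (mod int b)"
    using n(1) \<open>c mod int b \<in> ?I\<close> by (simp add: cong_def)
  ultimately show False by blast
qed

end

section \<open>Automata below the identity\<close>

locale monotone_automaton = sieve_automaton +
  assumes monotone: "x \<in> X \<Longrightarrow> \<tau> x 0 \<Longrightarrow> x 0"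
begin

lemma monotone_at: "x \<in> X \<Longrightarrow> \<tau> x n \<Longrightarrow> x n"
  using monotone[OF shift_power_in_X[of x n]] by (simp add: eval_at shift_power_apply)

lemma identityI:
  assumes "\<And>x. x \<in> X \<Longrightarrow> x 0 \<Longrightarrow> \<tau> x 0" and x: "x \<in> X"
  shows "\<tau> x = x"
proof
  fix n
  show "\<tau> x n = x n"
    using assms(1)[OF shift_power_in_X[OF x, of n]] monotone_at[OF x, of n]
    by (auto simp: eval_at[OF x] shift_power_apply)
qed

text \<open>A block that is not fixed extends to an admissible configuration all of whose admissible
  enlargements carry the same block; such a configuration has no preimage.\<close>

lemma surjective_imp_identity:
  assumes surj: "\<tau> ` X = X" and x: "x \<in> X"
  shows "\<tau> x = x"
proof (rule identityI[OF _ x])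
  fix x assume x: "x \<in> X" and x0: "x 0"
  let ?W = "{- int l..int l}"
  let ?A = "{j\<in>?W. x j}"
  have A: "finite ?A" by (rule finite_subset[of _ ?W]) auto
  have "admissible B ?A" using x unfolding mem_X by (rule adm_mono) (auto simp: support_def)
  moreover have "finite (?W - ?A)" "(?W - ?A) \<inter> ?A = {}" "?W - ?A \<subseteq> {..int l}" by auto
  ultimately obtain F where F: "admissible B F" "?A \<subseteq> F"
    "\<forall>G. admissible B G \<and> F \<subseteq> G \<longrightarrow> (?W - ?A) \<inter> G = {}"
    using ex_admissible_excluding[OF A] by meson
  have "(\<lambda>j. j \<in> F) \<in> X" using F(1) by (simp add: mem_X)
  then obtain y where y: "y \<in> X" "\<tau> y = (\<lambda>j. j \<in> F)" using surj by (metis imageE)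
  \<comment> \<open>Monotonicity makes \<open>support y\<close> an admissible enlargement of
    \<open>F\<close>, so \<open>y\<close> agrees with \<open>x\<close> on the window.\<close>
  have sub: "F \<subseteq> support y" using monotone_at[OF y(1)] y(2) by (auto simp: support_def)
  then have "(?W - ?A) \<inter> support y = {}" using F(3) y(1) mem_X by blast
  then have "\<forall>i\<in>?W. y i = x i" using sub F(2) by (auto simp: support_def)
  then have "\<tau> x 0 = \<tau> y 0" using local[OF y(1) x] by simp
  then show "\<tau> x 0" using y(2) F(2) x0 by auto
qed

text \<open>On configurations of finite support \<open>\<tau>\<close> is an injective map with \<open>\<tau> x \<le> x\<close>, hence the
  identity by induction on the support.\<close>

lemma pre_injective_imp_identity:
  assumes inj: "pre_injective_on X \<tau>" and x: "x \<in> X"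
  shows "\<tau> x = x"
proof (rule identityI[OF _ x])
  have fixed: "\<tau> (\<lambda>j. j \<in> A) = (\<lambda>j. j \<in> A)" if "finite A" "admissible B A" for A
    using that
  proof (induction A rule: finite_psubset_induct)
    case (psubset A)
    have AX: "(\<lambda>j. j \<in> A) \<in> X" using psubset.prems by (simp add: mem_X)
    define A' where "A' = support (\<tau> (\<lambda>j. j \<in> A))"
    have \<tau>A: "\<tau> (\<lambda>j. j \<in> A) = (\<lambda>j. j \<in> A')" by (simp add: A'_def support_def)
    have sub: "A' \<subseteq> A" using monotone_at[OF AX] by (auto simp: A'_def support_def)
    have "A' = A"
    proof (rule ccontr)
      assume "A' \<noteq> A"
      then have "A' \<subset> A" using sub by blast
      moreover have A'X: "(\<lambda>j. j \<in> A') \<in> X" using range[OF AX] \<tau>A by simp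
      \<comment> \<open>By induction the smaller set \<open>A'\<close> is fixed, and it is also the
        image of \<open>A\<close>.\<close>
      ultimately have "\<tau> (\<lambda>j. j \<in> A') = \<tau> (\<lambda>j. j \<in> A)"
        using psubset.IH \<tau>A by (simp add: mem_X)
      moreover have "finite {j. (j \<in> A') \<noteq> (j \<in> A)}"
        by (rule finite_subset[OF _ psubset.hyps(1)]) (use sub in auto)
      ultimately have "(\<lambda>j. j \<in> A') = (\<lambda>j. j \<in> A)"
        using inj A'X AX unfolding pre_injective_on_def by blast
      then show False using \<open>A' \<noteq> A\<close> by (metis Collect_mem_eq)
    qed
    then show ?case using \<tau>A by simp
  qed
  fix x assume x: "x \<in> X" and x0: "x 0"
  let ?A = "{j\<in>{- int l..int l}. x j}"
  have "finite ?A" by (rule finite_subset[of _ "{- int l..int l}"]) auto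
  moreover have "admissible B ?A" using x unfolding mem_X by (rule adm_mono) (auto simp: support_def)
  ultimately have "\<tau> (\<lambda>j. j \<in> ?A) = (\<lambda>j. j \<in> ?A)" by (rule fixed)
  from fun_cong[OF this, of 0] show "\<tau> x 0" unfolding local_truncate[OF x] using x0 by simp
qed

end

section \<open>Normalising an automaton by a shift\<close>

context sieve_automaton
begin

text \<open>Shifting the input by \<open>- t\<close> moves its coordinate 0 to \<open>t\<close>, the
  forced position; the radius grows by the size of the shift.\<close>

lemma monotone_automaton_shift:
  assumes t: "\<forall>x\<in>X. \<tau> x 0 \<longrightarrow> x t"
  shows "monotone_automaton B (\<tau> \<circ> shift_power (- t)) (l + nat \<bar>t\<bar>)"
proof unfold_locales
  show "(\<tau> \<circ> shift_power (- t)) x \<in> X" if "x \<in> X" for x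
    using that by (simp add: range shift_power_in_X)
  show "(\<tau> \<circ> shift_power (- t)) (shift_power n x) = shift_power n ((\<tau> \<circ> shift_power (- t)) x)"
    if "x \<in> X" for x n
    using that by (simp add: equivariant shift_power_add add.commute)
  show "(\<tau> \<circ> shift_power (- t)) x 0 = (\<tau> \<circ> shift_power (- t)) y 0"
    if "x \<in> X" "y \<in> X" "\<forall>i\<in>{- int (l + nat \<bar>t\<bar>)..int (l + nat \<bar>t\<bar>)}. x i = y i" for x y
  proof -
    have "x (i - t) = y (i - t)" if "i \<in> {- int l..int l}" for i
    proof -
      have "i - t \<in> {- int (l + nat \<bar>t\<bar>)..int (l + nat \<bar>t\<bar>)}" using that by auto
      then show ?thesis using \<open>\<forall>i\<in>_. x i = y i\<close> by blast
    qed
    then show ?thesis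
      unfolding o_def using that(1,2) by (intro local shift_power_in_X) (auto simp: shift_power_apply)
  qed
  show "x 0" if "x \<in> X" "(\<tau> \<circ> shift_power (- t)) x 0" for x
    using bspec[OF t shift_power_in_X[OF that(1), of "- t"]] that(2) by (simp add: shift_power_apply)
qed

lemma ex_monotone_code:
  "\<exists>t l \<phi>. given_by_code X l \<phi> (\<tau> \<circ> shift_power t) \<and> monotone_code X l \<phi>"
proof -
  from ex_forced_coordinate obtain t where t: "\<forall>x\<in>X. \<tau> x 0 \<longrightarrow> x t" ..
  have \<sigma>: "monotone_automaton B (\<tau> \<circ> shift_power (- t)) (l + nat \<bar>t\<bar>)"
    using t by (rule monotone_automaton_shift)
  have "monotone_code X (l + nat \<bar>t\<bar>)
    (\<lambda>C. \<exists>x\<in>X. block x 0 (l + nat \<bar>t\<bar>) = C \<and> (\<tau> \<circ> shift_power (- t)) x 0)"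
    using monotone_automaton.monotone[OF \<sigma>] by (auto simp: monotone_code_def block_0)
  moreover note sieve_automaton.given_by_local_code[OF monotone_automaton.axioms(1)[OF \<sigma>]]
  ultimately show ?thesis by blast
qed

text \<open>Shifts are bijections of \<open>X\<close>, so either hypothesis passes to the normalised
  automaton and makes it the identity there.\<close>

lemma shift_if_surjective_or_pre_injective:
  assumes "\<tau> ` X = X \<or> pre_injective_on X \<tau>"
  shows "\<exists>t. \<forall>x\<in>X. \<tau> x = shift_power t x"
proof -
  from ex_forced_coordinate obtain t where t: "\<forall>x\<in>X. \<tau> x 0 \<longrightarrow> x t" ..
  let ?\<sigma> = "\<tau> \<circ> shift_power (- t)"
  have mono: "monotone_automaton B ?\<sigma> (l + nat \<bar>t\<bar>)"
    using t by (rule monotone_automaton_shift)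
  have \<sigma>: "?\<sigma> x = shift_power (- t) (\<tau> x)" if "x \<in> X" for x
    using that by (simp add: equivariant)
  have "?\<sigma> ` X = X" if "\<tau> ` X = X"
  proof (intro equalityI subsetI)
    fix x assume "x \<in> X"
    then obtain y where y: "y \<in> X" "\<tau> y = x" using \<open>\<tau> ` X = X\<close> by (metis imageE)
    then have "?\<sigma> (shift_power t y) = x" by (simp add: shift_power_add)
    then show "x \<in> ?\<sigma> ` X" using shift_power_in_X[OF y(1)] by (metis imageI)
  qed (use range shift_power_in_X in auto)
  moreover have "pre_injective_on X ?\<sigma>" if "pre_injective_on X \<tau>"
  proof -
    have "\<tau> x = \<tau> y" if "x \<in> X" "y \<in> X" "?\<sigma> x = ?\<sigma> y" for x y
      using arg_cong[OF that(3), of "shift_power t"] unfolding \<sigma>[OF that(1)] \<sigma>[OF that(2)]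
      by (simp add: shift_power_add)
    then show ?thesis using \<open>pre_injective_on X \<tau>\<close> unfolding pre_injective_on_def by blast
  qed
  ultimately have "?\<sigma> x = x" if "x \<in> X" for x
    using assms that monotone_automaton.surjective_imp_identity[OF mono]
      monotone_automaton.pre_injective_imp_identity[OF mono] by blast
  \<comment> \<open>Evaluate the identity \<open>?\<sigma>\<close> at
    \<open>shift_power t x\<close>.\<close>
  then have "\<tau> x = shift_power t x" if "x \<in> X" for x
    using shift_power_in_X[OF that, of t] by (fastforce simp: shift_power_add)
  then show ?thesis by blast
qed

text \<open>Either property makes \<open>\<tau>\<close> a shift on \<open>X\<close>, and a shift is
  bijective.\<close>

lemma surjective_iff_pre_injective: "\<tau> ` X = X \<longleftrightarrow> pre_injective_on X \<tau>"
proof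
  assume "\<tau> ` X = X"
  then obtain t where t: "\<And>x. x \<in> X \<Longrightarrow> \<tau> x = shift_power t x"
    using shift_if_surjective_or_pre_injective by blast
  have "x = y" if "x \<in> X" "y \<in> X" "\<tau> x = \<tau> y" for x y
    using arg_cong[OF that(3), of "shift_power (- t)"] t that(1,2) by (simp add: shift_power_add)
  then show "pre_injective_on X \<tau>" unfolding pre_injective_on_def by blast
next
  assume "pre_injective_on X \<tau>"
  then obtain t where t: "\<And>x. x \<in> X \<Longrightarrow> \<tau> x = shift_power t x"
    using shift_if_surjective_or_pre_injective by blast
  show "\<tau> ` X = X"
  proof (intro equalityI subsetI)
    fix x assume x: "x \<in> X"
    have "\<tau> (shift_power (- t) x) = x" using t[OF shift_power_in_X[OF x]] by (simp add: shift_power_add)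
    then show "x \<in> \<tau> ` X" using shift_power_in_X[OF x] by (metis imageI)
  qed (use range in auto)
qed

end

text \<open>The radius comes from the coordinate 0 of \<open>\<tau>\<close>, a continuous map on the
  compact set \<open>X\<close>.\<close>

lemma (in coprime_sieve) ex_sieve_automaton:
  assumes "closed X" "cellular_automaton X \<tau>"
  shows "\<exists>l. sieve_automaton B \<tau> l"
proof -
  have \<tau>: "\<And>x. x \<in> X \<Longrightarrow> \<tau> x \<in> X" "continuous_on X \<tau>" "\<And>x. x \<in> X \<Longrightarrow> \<tau> (shift x) = shift (\<tau> x)"
    using assms(2) by (auto simp: cellular_automaton_def)
  have "compact X" using closed_Int_compact[OF assms(1) compact_config] by simp
  moreover have "continuous_on X (\<lambda>x. \<tau> x 0)"
    using \<tau>(2) by (rule continuous_on_product_then_coordinatewise)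
  ultimately obtain l where "\<forall>x\<in>X. \<forall>y\<in>X. (\<forall>i\<in>{- int l..int l}. x i = y i) \<longrightarrow> \<tau> x 0 = \<tau> y 0"
    using continuous_on_compact_local by blast
  moreover have "\<tau> (shift_power n x) = shift_power n (\<tau> x)" if "x \<in> X" for n x
    by (rule equivariant_shift_power) (use \<tau> that in auto)
  ultimately have "sieve_automaton B \<tau> l"
    using \<tau>(1) by unfold_locales blast+
  then show ?thesis ..
qed

theorem theorem4p8:
  fixes B :: "nat set"
  assumes positive: "0 \<notin> B"
    and primitive: "primitive B"
    and nontrivial: "B \<noteq> {1}"
    and admissible: "free_subshift B = admissible_subshift B"
  shows "(\<forall>\<tau>. cellular_automaton (free_subshift B) \<tau> \<longrightarrow>
            (\<tau> ` free_subshift B = free_subshift B \<longleftrightarrow> pre_injective_on (free_subshift B) \<tau>))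
    \<and> (\<forall>\<tau>. cellular_automaton (free_subshift B) \<tau> \<longrightarrow>
            (\<exists>t l \<phi>. given_by_code (free_subshift B) l \<phi> (\<tau> \<circ> shift_power t) \<and>
                     monotone_code (free_subshift B) l \<phi>))
    \<and> (\<forall>\<tau>. cellular_automaton (free_subshift B) \<tau> \<and> \<tau> ` free_subshift B = free_subshift B \<longrightarrow>
            (\<exists>t. \<forall>x\<in>free_subshift B. \<tau> x = shift_power t x))"
proof -
  have one: "1 \<notin> B"
  proof
    assume "1 \<in> B"
    then have "B = {1}" using primitive unfolding primitive_def by (metis one_dvd singleton_iff subsetI subset_antisym)
    then show False using nontrivial by simp
  qed
  interpret coprime_sieve B
  proof
    show "b > 1" if "b \<in> B" for b
      using that positive one by (metis less_one linorder_neqE_nat)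
    show "coprime a b" if "a \<in> B" "b \<in> B" "a \<noteq> b" for a b
      using sieve_coprime[OF positive primitive ex_pattern_realised[OF admissible] that] .
    show "infinite B" by (rule sieve_infinite[OF positive one admissible])
  qed
  \<comment> \<open>As the free subshift, \<open>X\<close> is an orbit closure.\<close>
  have "closed X" unfolding admissible[symmetric] free_subshift_def by simp
  then have CA: "\<exists>l. sieve_automaton B \<tau> l" if "cellular_automaton X \<tau>" for \<tau>
    using that by (rule ex_sieve_automaton)
  show ?thesis
    unfolding admissible
  proof (intro conjI allI impI)
    fix \<tau> assume "cellular_automaton X \<tau>"
    then obtain l where "sieve_automaton B \<tau> l" using CA by blast
    then interpret sieve_automaton B \<tau> l .
    show "\<tau> ` X = X \<longleftrightarrow> pre_injective_on X \<tau>" by (rule surjective_iff_pre_injective)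
    show "\<exists>t l \<phi>. given_by_code X l \<phi> (\<tau> \<circ> shift_power t) \<and> monotone_code X l \<phi>"
      by (rule ex_monotone_code)
  next
    fix \<tau> assume \<tau>: "cellular_automaton X \<tau> \<and> \<tau> ` X = X"
    then obtain l where "sieve_automaton B \<tau> l" using CA by blast
    then interpret sieve_automaton B \<tau> l .
    show "\<exists>t. \<forall>x\<in>X. \<tau> x = shift_power t x"
      using \<tau> shift_if_surjective_or_pre_injective by simp
  qed
qed

end
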